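(* Let $p\in[1,+\infty]$, let $C$ be a bivariate copula with $\mu_p(C)>0$, and let $S$ be a bivariate copula with $S^t=S$. For any $\mu_0\in[0,\mu_p(C)]$, the copula $D_\alpha:=\alpha C+(1-\alpha)S$ with $\alpha=\mu_0/\mu_p(C)$ satisfies $\mu_p(D_\alpha)=\mu_0$.
   Context: A (bivariate) copula is a function $C:[0,1]^2\to[0,1]$ with $C(t,0)=C(0,t)=0$, $C(t,1)=C(1,t)=t$ for all $t\in[0,1]$, and $C(u',v')-C(u,v')-C(u',v)+C(u,v)\ge 0$ whenever $u\le u'$, $v\le v'$ in $[0,1]$. The transpose is $C^t(u,v)=C(v,u)$. For $p\in[1,\infty)$, $\mu_p(C)=\left(\int_{[0,1]^2}|C(u,v)-C(v,u)|^p\,du\,dv\right)^{1/p}$, and $\mu_\infty(C)=\sup_{(u,v)\in[0,1]^2}|C(u,v)-C(v,u)|$. *)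

theory Defs
  imports "HOL-Analysis.Analysis"
begin

text \<open>
  Functions on the unit square are represented by total curried functions on the reals;
  values outside the unit square are arbitrary and are never referred to.
\<close>

definition is_copula :: "(real \<Rightarrow> real \<Rightarrow> real) \<Rightarrow> bool" where
  "is_copula C \<longleftrightarrow>
     (\<forall>u\<in>{0..1}. \<forall>v\<in>{0..1}. C u v \<in> {0..1}) \<and>
     (\<forall>t\<in>{0..1}. C t 0 = 0 \<and> C 0 t = 0) \<and>
     (\<forall>t\<in>{0..1}. C t 1 = t \<and> C 1 t = t) \<and>
     (\<forall>u\<in>{0..1}. \<forall>u'\<in>{0..1}. \<forall>v\<in>{0..1}. \<forall>v'\<in>{0..1}.
        u \<le> u' \<longrightarrow> v \<le> v' \<longrightarrow> C u' v' - C u v' - C u' v + C u v \<ge> 0)"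

definition copula_transpose :: "(real \<Rightarrow> real \<Rightarrow> real) \<Rightarrow> real \<Rightarrow> real \<Rightarrow> real" where
  "copula_transpose C = (\<lambda>u v. C v u)"

text \<open>
  The exponent ranges over \<open>[1, \<infinity>]\<close>, hence its type; the definition is
  meaningful only for exponents at least 1. For copulas the integrand is continuous and
  bounded on the unit square, so the Lebesgue integral and the real supremum are proper.
\<close>

definition asymmetry :: "ereal \<Rightarrow> (real \<Rightarrow> real \<Rightarrow> real) \<Rightarrow> real" where
  "asymmetry p C =
     (if p = \<infinity>
      then (SUP (u, v)\<in>{0..1} \<times> {0..1}. \<bar>C u v - C v u\<bar>)
      else (set_lebesgue_integral lborel ({0..1} \<times> {0..1})
              (\<lambda>(u, v). \<bar>C u v - C v u\<bar> powr real_of_ereal p))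
           powr (1 / real_of_ereal p))"

end

theory Submission
  imports Defs
begin

text \<open>
  Since \<open>S\<close> is symmetric, the antisymmetric part of \<open>D\<close> is \<open>\<alpha>\<close> times that of \<open>C\<close>, and
  \<open>asymmetry p\<close> is positively homogeneous in the antisymmetric part.
\<close>

lemma is_copula_range: "is_copula C \<Longrightarrow> u \<in> {0..1} \<Longrightarrow> v \<in> {0..1} \<Longrightarrow> C u v \<in> {0..1}"
  unfolding is_copula_def by blast

lemma is_copula_boundary:
  assumes "is_copula C" "t \<in> {0..1}"
  shows "C t 0 = 0" "C 0 t = 0" "C t 1 = t" "C 1 t = t"
  using assms by (simp_all add: is_copula_def)

lemma is_copula_rectangle:
  assumes "is_copula C" "u \<in> {0..1}" "u' \<in> {0..1}" "v \<in> {0..1}" "v' \<in> {0..1}" "u \<le> u'" "v \<le> v'"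
  shows "0 \<le> C u' v' - C u v' - C u' v + C u v"
  using assms unfolding is_copula_def by simp

text \<open>The boundary conditions are affine in the copula, while the range condition and the
  rectangle inequality cut out convex sets, so each of them survives a convex combination.\<close>

lemma is_copula_convex_combination:
  assumes C: "is_copula C" and S: "is_copula S" and a: "0 \<le> a" "a \<le> 1"
  shows "is_copula (\<lambda>u v. a * C u v + (1 - a) * S u v)"
proof -
  have range: "a * C u v + (1 - a) * S u v \<in> {0..1}" if "u \<in> {0..1}" "v \<in> {0..1}" for u v
  proof -
    have "C u v \<in> {0..1}" "S u v \<in> {0..1}"
      using is_copula_range[OF C that] is_copula_range[OF S that] by auto
    moreover from this have "a * C u v + (1 - a) * S u v \<le> 1"
      using a convex_bound_le[of "C u v" 1 "S u v" a "1 - a"] by simp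
    ultimately show ?thesis
      using a by simp
  qed
  have rectangle: "0 \<le> (a * C u' v' + (1 - a) * S u' v') - (a * C u v' + (1 - a) * S u v')
      - (a * C u' v + (1 - a) * S u' v) + (a * C u v + (1 - a) * S u v)"
    if "u \<in> {0..1}" "u' \<in> {0..1}" "v \<in> {0..1}" "v' \<in> {0..1}" "u \<le> u'" "v \<le> v'" for u u' v v'
  proof -
    have "0 \<le> C u' v' - C u v' - C u' v + C u v" "0 \<le> S u' v' - S u v' - S u' v + S u v"
      using is_copula_rectangle[OF C that] is_copula_rectangle[OF S that] by auto
    \<comment> \<open>The rectangle volume is linear in the function, so the volume of the
      combination is the same combination of two nonnegative volumes.\<close>
    then have "0 \<le> a * (C u' v' - C u v' - C u' v + C u v)
        + (1 - a) * (S u' v' - S u v' - S u' v + S u v)"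
      using a by simp
    then show ?thesis
      by (simp add: algebra_simps)
  qed
  have boundary: "a * C t 0 + (1 - a) * S t 0 = 0" "a * C 0 t + (1 - a) * S 0 t = 0"
    "a * C t 1 + (1 - a) * S t 1 = t" "a * C 1 t + (1 - a) * S 1 t = t" if "t \<in> {0..1}" for t
    using is_copula_boundary[OF C that] is_copula_boundary[OF S that]
    by (simp_all add: algebra_simps)
  show ?thesis
    unfolding is_copula_def
    by (intro conjI ballI impI) (fact range boundary rectangle)+
qed

text \<open>Multiplication by \<open>c\<close> is continuous and, for \<open>0 \<le> c\<close>,
  monotone, so it commutes with the supremum of a nonempty set that is bounded above.\<close>

lemma cSUP_mult_left_real:
  fixes f :: "'a \<Rightarrow> real"
  assumes "A \<noteq> {}" "bdd_above (f ` A)" "0 \<le> c"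
  shows "(SUP x\<in>A. c * f x) = c * (SUP x\<in>A. f x)"
proof -
  have "c * Sup (f ` A) = (SUP y\<in>f ` A. c * y)"
    using assms by (intro continuous_at_Sup_mono) (auto intro: monoI mult_left_mono continuous_intros)
  then show ?thesis
    by (simp add: image_image)
qed

text \<open>As \<open>a\<close> is nonnegative, it leaves the absolute value unchanged. For
  \<open>p = \<infinity>\<close> it then passes through the supremum; for a finite exponent
  \<open>r\<close> it leaves the integral as \<open>a powr r\<close>, and the outer root restores
  \<open>a\<close>. The identity \<open>D\<close> is stated on the unit square because
  \<open>asymmetry\<close> evaluates its argument only there.\<close>

lemma asymmetry_homogeneous:
  assumes p: "1 \<le> p" and C: "is_copula C" and a: "0 \<le> a"
    and D: "\<And>u v. u \<in> {0..1} \<Longrightarrow> v \<in> {0..1} \<Longrightarrow> D u v - D v u = a * (C u v - C v u)"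
  shows "asymmetry p D = a * asymmetry p C"
proof (cases "p = \<infinity>")
  case True
  let ?Q = "{0..1::real} \<times> {0..1::real}"
  let ?f = "\<lambda>(u, v). \<bar>C u v - C v u\<bar>"
  \<comment> \<open>Two values in the unit interval differ by at most 1; this supplies the upper
    bound that makes the real supremum meaningful.\<close>
  have "?f x \<le> 1" if "x \<in> ?Q" for x
  proof -
    obtain u v where x: "x = (u, v)" "u \<in> {0..1}" "v \<in> {0..1}"
      using \<open>x \<in> ?Q\<close> by blast
    then have "C u v \<in> {0..1}" "C v u \<in> {0..1}"
      using is_copula_range[OF C x(2,3)] is_copula_range[OF C x(3,2)] by auto
    then show ?thesis
      using x by auto
  qed
  then have bdd: "bdd_above (?f ` ?Q)"
    by (intro bdd_aboveI2[where M = 1])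
  have "(SUP (u, v)\<in>?Q. \<bar>D u v - D v u\<bar>) = (SUP x\<in>?Q. a * ?f x)"
    by (intro SUP_cong refl) (use D a in \<open>auto simp: abs_mult\<close>)
  also have "\<dots> = a * (SUP x\<in>?Q. ?f x)"
    using bdd a by (intro cSUP_mult_left_real) auto
  finally show ?thesis
    using True by (simp add: asymmetry_def)
next
  case False
  with p obtain r where r: "p = ereal r" "1 \<le> r"
    by (cases p) auto
  let ?Q = "{0..1::real} \<times> {0..1::real}"
  let ?f = "\<lambda>(u, v). \<bar>C u v - C v u\<bar> powr r"
  define I where "I = set_lebesgue_integral lborel ?Q ?f"
  have "0 \<le> I"
    unfolding I_def set_lebesgue_integral_def
    by (intro Bochner_Integration.integral_nonneg) (auto simp: indicator_def split: prod.split)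
  have "set_lebesgue_integral lborel ?Q (\<lambda>(u, v). \<bar>D u v - D v u\<bar> powr r)
      = (LINT x:?Q|lborel. a powr r * ?f x)"
    unfolding set_lebesgue_integral_def
    by (intro Bochner_Integration.integral_cong refl)
      (use D a in \<open>auto simp: indicator_def abs_mult powr_mult\<close>)
  \<comment> \<open>A constant leaves the integral for every integrand, a non-integrable one having
    integral 0 by default, so no integrability has to be shown.\<close>
  also have "\<dots> = a powr r * I"
    by (simp add: I_def)
  finally have "asymmetry p D = (a powr r * I) powr (1 / r)"
    using r by (simp add: asymmetry_def)
  \<comment> \<open>Both factors are nonnegative, so the root distributes, and the exponents
    \<open>r\<close> and \<open>1 / r\<close> cancel on \<open>a\<close>; the case
    \<open>a = 0\<close> is covered by \<open>0 powr x = 0\<close>.\<close>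
  also have "\<dots> = a * I powr (1 / r)"
    using a r \<open>0 \<le> I\<close> by (simp add: powr_mult powr_powr)
  finally show ?thesis
    using r by (simp add: asymmetry_def I_def)
qed

theorem corollary8:
  fixes p :: ereal and C S :: "real \<Rightarrow> real \<Rightarrow> real" and \<mu>\<^sub>0 :: real
  assumes "1 \<le> p"
    and "is_copula C"
    and "asymmetry p C > 0"
    and "is_copula S"
    and "\<forall>u\<in>{0..1}. \<forall>v\<in>{0..1}. copula_transpose S u v = S u v"
    and "\<mu>\<^sub>0 \<in> {0..asymmetry p C}"
  shows "let \<alpha> = \<mu>\<^sub>0 / asymmetry p C;
             D = (\<lambda>u v. \<alpha> * C u v + (1 - \<alpha>) * S u v)
         in is_copula D \<and> asymmetry p D = \<mu>\<^sub>0"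
proof -
  define a where "a = \<mu>\<^sub>0 / asymmetry p C"
  \<comment> \<open>Positivity of \<open>asymmetry p C\<close> makes the quotient genuine, and the
    range of \<open>\<mu>\<^sub>0\<close> places it in the unit interval.\<close>
  have a: "0 \<le> a" "a \<le> 1" "a * asymmetry p C = \<mu>\<^sub>0"
    using assms by (auto simp: a_def)
  have "asymmetry p (\<lambda>u v. a * C u v + (1 - a) * S u v) = a * asymmetry p C"
  proof (rule asymmetry_homogeneous[OF assms(1,2) a(1)])
    fix u v :: real
    assume "u \<in> {0..1}" "v \<in> {0..1}"
    then have "S v u = S u v"
      using assms(5) by (simp add: copula_transpose_def)
    then show "(a * C u v + (1 - a) * S u v) - (a * C v u + (1 - a) * S v u)
        = a * (C u v - C v u)"
      by (simp add: algebra_simps)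
  qed
  then show ?thesis
    using is_copula_convex_combination[OF assms(2,4) a(1,2)] a(3)
    by (simp add: a_def Let_def)
qed

end
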